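(* Let $r$ be a positive integer. If $H$ is an $r$-layer hexagonal silicate sheet, then $\mathrm{gt}(H)=3(r^2+r)$.
   Context: A geodesic in a graph $G$ is a shortest path between two vertices. A geodesic is maximal if it is not a (proper) subpath of another geodesic of $G$. A set $S\subseteq V(G)$ is a geodesic transversal of $G$ if every maximal geodesic of $G$ contains at least one vertex of $S$. The geodesic transversal number $\mathrm{gt}(G)$ is the minimum cardinality of a geodesic transversal of $G$. The $r$-layer hexagonal carbon nanosheet is the finite subgraph of the hexagonal lattice consisting of all vertices and edges of a central hexagon and of the $r-1$ layers of hexagons around it (i.e. of all hexagons at distance at most $r-1$ from the central one, where two hexagons are neighbors if they share an edge). The $1$-layer hexagonal carbon nanosheet is a single $6$-cycle. A silicate sheet is a graph whose vertices are silicon vertices and oxygen vertices, where each edge joins a silicon vertex and an oxygen vertex, each silicon vertex has exactly $4$ oxygen neighbors, each oxygen vertex has one or two silicon neighbors, and two silicon vertices have at most one common oxygen neighbor. Smoothing a vertex $v$ of degree $2$ with neighbors $x,y$ means removing $v$ and adding the edge $xy$. For a silicate sheet $H$, let $\mathrm{SM}(H)$ be the graph obtained from $H$ by smoothing all vertices of degree $2$. If the graph obtained from $\mathrm{SM}(H)$ by deleting all of its pendant vertices (vertices of degree $1$) is the $r$-layer hexagonal carbon nanosheet, then $H$ is called an $r$-layer hexagonal silicate sheet. Equivalently, $H$ is obtained from the $r$-layer hexagonal carbon nanosheet $G$ by subdividing every edge exactly once and attaching $4-\deg_G(v)$ pendant vertices to each vertex $v\in V(G)$. *)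

theory Defs
  imports Main "HOL-Library.Sublist"
begin

section \<open>Finite simple graphs\<close>

record 'a ugraph =
  verts :: "'a set"
  edges :: "'a set set"

definition simple_graph :: "'a ugraph \<Rightarrow> bool" where
  "simple_graph G \<longleftrightarrow> finite (verts G) \<and> (\<forall>e\<in>edges G. e \<subseteq> verts G \<and> card e = 2)"

definition nbrs :: "'a ugraph \<Rightarrow> 'a \<Rightarrow> 'a set" where
  "nbrs G v = {w. {v, w} \<in> edges G}"

definition degree :: "'a ugraph \<Rightarrow> 'a \<Rightarrow> nat" where
  "degree G v = card (nbrs G v)"

definition isomorphic :: "'a ugraph \<Rightarrow> 'b ugraph \<Rightarrow> bool" where
  "isomorphic G G' \<longleftrightarrow>
     (\<exists>f. bij_betw f (verts G) (verts G') \<and>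
          (\<forall>u\<in>verts G. \<forall>v\<in>verts G. {u, v} \<in> edges G \<longleftrightarrow> {f u, f v} \<in> edges G'))"


section \<open>Geodesic transversals\<close>

text \<open>Paths are given by their vertex sequence; a path and its reversal are both listed.
  One-vertex paths are allowed.\<close>

definition is_path :: "'a ugraph \<Rightarrow> 'a list \<Rightarrow> bool" where
  "is_path G p \<longleftrightarrow> p \<noteq> [] \<and> distinct p \<and> set p \<subseteq> verts G \<and>
     (\<forall>i. Suc i < length p \<longrightarrow> {p ! i, p ! Suc i} \<in> edges G)"

definition geodesic :: "'a ugraph \<Rightarrow> 'a list \<Rightarrow> bool" where
  "geodesic G p \<longleftrightarrow> is_path G p \<and>
     (\<forall>q. is_path G q \<and> hd q = hd p \<and> last q = last p \<longrightarrow> length p \<le> length q)"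

text \<open>It is enough to consider \<open>strict_sublist p q\<close>: if \<open>p\<close> is traversed backwards by \<open>q\<close>,
  then it is a contiguous sublist of \<open>rev q\<close>, which is a geodesic as well.\<close>

definition maximal_geodesic :: "'a ugraph \<Rightarrow> 'a list \<Rightarrow> bool" where
  "maximal_geodesic G p \<longleftrightarrow> geodesic G p \<and> \<not> (\<exists>q. geodesic G q \<and> strict_sublist p q)"

definition geodesic_transversal :: "'a ugraph \<Rightarrow> 'a set \<Rightarrow> bool" where
  "geodesic_transversal G S \<longleftrightarrow>
     S \<subseteq> verts G \<and> (\<forall>p. maximal_geodesic G p \<longrightarrow> set p \<inter> S \<noteq> {})"

definition gt :: "'a ugraph \<Rightarrow> nat" where
  "gt G = (LEAST k. \<exists>S. geodesic_transversal G S \<and> finite S \<and> card S = k)"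


section \<open>Hexagonal carbon nanosheets\<close>

text \<open>The hexagonal lattice has two vertices in each unit cell \<open>(a, b)\<close> of a triangular lattice
  of translations. With translation vectors \<open>e1\<close>, \<open>e2\<close> at an angle of 60 degrees, the vertex
  \<open>(a, b, False)\<close> sits at \<open>a e1 + b e2\<close>, and \<open>(a, b, True)\<close> at the centroid of the triangle
  formed by \<open>(a, b, False)\<close>, \<open>(a + 1, b, False)\<close> and \<open>(a, b + 1, False)\<close>,
  which are its three neighbours.\<close>

type_synonym hex_vertex = "int \<times> int \<times> bool"

definition hex_lattice :: "hex_vertex ugraph" where
  "hex_lattice = \<lparr> verts = UNIV,
     edges = (\<Union>a b. {{(a, b, True), (a, b, False)},
                     {(a, b, True), (a + 1, b, False)},
                     {(a, b, True), (a, b + 1, False)}}) \<rparr>"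

text \<open>The hexagons (faces) of the lattice are indexed by pairs of integers. The vertices of a
  hexagon are listed in cyclic order, and its six edges are those of the lattice joining two of them.\<close>

fun hexagon_verts :: "int \<times> int \<Rightarrow> hex_vertex set" where
  "hexagon_verts (a, b) =
     {(a, b, False), (a, b, True), (a + 1, b, False),
      (a + 1, b - 1, True), (a + 1, b - 1, False), (a, b - 1, True)}"

definition hexagon_edges :: "int \<times> int \<Rightarrow> hex_vertex set set" where
  "hexagon_edges h = {e \<in> edges hex_lattice. e \<subseteq> hexagon_verts h}"

definition neighbouring_hexagons :: "int \<times> int \<Rightarrow> int \<times> int \<Rightarrow> bool" where
  "neighbouring_hexagons h h' \<longleftrightarrow> h \<noteq> h' \<and> hexagon_edges h \<inter> hexagon_edges h' \<noteq> {}"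

text \<open>The hexagons at distance at most \<open>n\<close> from the central hexagon \<open>(0, 0)\<close>.\<close>

fun hexagons_within :: "nat \<Rightarrow> (int \<times> int) set" where
  "hexagons_within 0 = {(0, 0)}"
| "hexagons_within (Suc n) =
     hexagons_within n \<union> {h'. \<exists>h\<in>hexagons_within n. neighbouring_hexagons h h'}"

text \<open>Only meaningful for \<open>r \<ge> 1\<close>.\<close>

definition nanosheet :: "nat \<Rightarrow> hex_vertex ugraph" where
  "nanosheet r = \<lparr> verts = (\<Union>h\<in>hexagons_within (r - 1). hexagon_verts h),
                   edges = (\<Union>h\<in>hexagons_within (r - 1). hexagon_edges h) \<rparr>"


section \<open>Silicate sheets\<close>

definition silicate_sheet :: "'a ugraph \<Rightarrow> bool" where
  "silicate_sheet H \<longleftrightarrow> simple_graph H \<and>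
     (\<exists>Si Ox. verts H = Si \<union> Ox \<and> Si \<inter> Ox = {} \<and>
        (\<forall>e\<in>edges H. \<exists>s\<in>Si. \<exists>x\<in>Ox. e = {s, x}) \<and>
        (\<forall>s\<in>Si. card (nbrs H s \<inter> Ox) = 4) \<and>
        (\<forall>x\<in>Ox. card (nbrs H x \<inter> Si) \<in> {1, 2}) \<and>
        (\<forall>s\<in>Si. \<forall>t\<in>Si. s \<noteq> t \<longrightarrow> card (nbrs H s \<inter> nbrs H t \<inter> Ox) \<le> 1))"

text \<open>Smoothing is intended for vertices of degree 2, where exactly one edge is added.\<close>

definition smooth :: "'a \<Rightarrow> 'a ugraph \<Rightarrow> 'a ugraph" where
  "smooth v G = \<lparr> verts = verts G - {v},
     edges = {e \<in> edges G. v \<notin> e} \<union> {{x, y} | x y. x \<in> nbrs G v \<and> y \<in> nbrs G v \<and> x \<noteq> y} \<rparr>"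

text \<open>\<open>M\<close> arises from \<open>G\<close> by smoothing, one after the other, all vertices of degree 2 in \<open>G\<close>.
  In a silicate sheet these are pairwise non-adjacent oxygen vertices without a common pair of
  neighbours, so that their order is irrelevant and no parallel edges arise.\<close>

definition is_SM :: "'a ugraph \<Rightarrow> 'a ugraph \<Rightarrow> bool" where
  "is_SM G M \<longleftrightarrow>
     (\<exists>vs. distinct vs \<and> set vs = {v \<in> verts G. degree G v = 2} \<and> M = fold smooth vs G)"

definition delete_pendant :: "'a ugraph \<Rightarrow> 'a ugraph" where
  "delete_pendant G = (let V = {v \<in> verts G. degree G v \<noteq> 1}
     in \<lparr> verts = V, edges = {e \<in> edges G. e \<subseteq> V} \<rparr>)"

definition hexagonal_silicate_sheet :: "nat \<Rightarrow> 'a ugraph \<Rightarrow> bool" where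
  "hexagonal_silicate_sheet r H \<longleftrightarrow> silicate_sheet H \<and>
     (\<exists>M. is_SM H M \<and> isomorphic (delete_pendant M) (nanosheet r))"

end

(*
  Both bounds come from one set of silicon vertices. Every maximal geodesic either contains two
  silicon vertices with a common oxygen neighbour, or joins two pendant neighbours of one silicon
  vertex, which then has degree 2 in the nanosheet: indeed all other geodesics with at most one
  silicon vertex can be extended. Hence one colour class of the bipartite nanosheet together with
  the degree 2 vertices of the other class is a transversal, of size 3r^2 + 3r.
  It is optimal because there are as many disjoint maximal geodesics: one of length 2 at each
  vertex of degree 2, and one of length 4 for each edge of a perfect matching of the vertices of
  degree 3, namely the matching by the radial edges between consecutive rings of the nanosheet.
*)
theory Submission imports Defs
begin

section \<open>The nanosheet in coordinates\<close>

lemma hex_lattice_edge_iff: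
  "{(x, y, True), (a, b, False)} \<in> edges hex_lattice \<longleftrightarrow>
     (x, y) \<in> {(a, b), (a - 1, b), (a, b - 1)}"
proof -
  have eq: "{(x, y, True), (a, b, False)} = {(p, q, True), (u, v, False)} \<longleftrightarrow>
      x = p \<and> y = q \<and> a = u \<and> b = v" for p q u v
    by (auto simp: doubleton_eq_iff)
  have "{(x, y, True), (a, b, False)} \<in> edges hex_lattice \<longleftrightarrow>
      (a = x \<and> b = y) \<or> (a = x + 1 \<and> b = y) \<or> (a = x \<and> b = y + 1)"
    unfolding hex_lattice_def by (simp add: eq ex_disj_distrib)
  also have "\<dots> \<longleftrightarrow> (x, y) \<in> {(a, b), (a - 1, b), (a, b - 1)}"
    by (simp add: eq_diff_eq) argo
  finally show ?thesis .
qed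

lemma neighbouring_hexagons_iff:
  "neighbouring_hexagons (a, b) (c, d) \<longleftrightarrow>
     (c - a, d - b) \<in> {(1, 0), (- 1, 0), (0, 1), (0, - 1), (1, - 1), (- 1, 1)}"
proof
  \<comment> \<open>The three hexagons at a vertex are pairwise neighbours, so one shared vertex suffices.\<close>
  assume "neighbouring_hexagons (a, b) (c, d)"
  then obtain e where ne: "(a, b) \<noteq> (c, d)" and e: "e \<in> edges hex_lattice"
    "e \<subseteq> hexagon_verts (a, b)" "e \<subseteq> hexagon_verts (c, d)"
    unfolding neighbouring_hexagons_def hexagon_edges_def by blast
  from e(1) obtain x y where "(x, y, True) \<in> e" unfolding hex_lattice_def by auto
  moreover have "(x, y, True) \<in> hexagon_verts h \<Longrightarrow> h \<in> {(x, y), (x - 1, y + 1), (x, y + 1)}" for h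
    by (cases h) auto
  ultimately have "(a, b) \<in> {(x, y), (x - 1, y + 1), (x, y + 1)}"
    "(c, d) \<in> {(x, y), (x - 1, y + 1), (x, y + 1)}" using e(2,3) by blast+
  then show "(c - a, d - b) \<in> {(1, 0), (- 1, 0), (0, 1), (0, - 1), (1, - 1), (- 1, 1)}"
    using ne by (elim insertE emptyE Pair_inject) simp_all
next
  \<comment> \<open>Each of the six directions below is settled by naming the \<open>True\<close>
    and the \<open>False\<close> end of the edge that the two hexagons share.\<close>
  have shared: "neighbouring_hexagons (a, b) (c, d)"
    if "{(x, y, True), (u, v, False)} \<in> edges hex_lattice"
      "{(x, y, True), (u, v, False)} \<subseteq> hexagon_verts (a, b)"
      "{(x, y, True), (u, v, False)} \<subseteq> hexagon_verts (c, d)" "(a, b) \<noteq> (c, d)" for x y u v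
    using that unfolding neighbouring_hexagons_def hexagon_edges_def by blast
  assume "(c - a, d - b) \<in> {(1, 0), (- 1, 0), (0, 1), (0, - 1), (1, - 1), (- 1, 1)}"
  then obtain i j where "c = a + i" "d = b + j"
    "(i, j) \<in> {(1, 0), (- 1, 0), (0, 1), (0, - 1), (1, - 1), (- 1, 1 :: int)}"
    using that[of "c - a" "d - b"] by simp
  then consider "c = a + 1" "d = b" | "c = a - 1" "d = b" | "c = a" "d = b + 1"
    | "c = a" "d = b - 1" | "c = a + 1" "d = b - 1" | "c = a - 1" "d = b + 1"
    by auto
  then show "neighbouring_hexagons (a, b) (c, d)"
  proof cases
    case 1 then show ?thesis
      by (intro shared[of "a + 1" "b - 1" "a + 1" b]) (auto simp: hex_lattice_edge_iff)
  next
    case 2 then show ?thesis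
      by (intro shared[of a "b - 1" a b]) (auto simp: hex_lattice_edge_iff)
  next
    case 3 then show ?thesis
      by (intro shared[of a b "a + 1" b]) (auto simp: hex_lattice_edge_iff)
  next
    case 4 then show ?thesis
      by (intro shared[of a "b - 1" "a + 1" "b - 1"]) (auto simp: hex_lattice_edge_iff)
  next
    case 5 then show ?thesis
      by (intro shared[of "a + 1" "b - 1" "a + 1" "b - 1"]) (auto simp: hex_lattice_edge_iff)
  next
    case 6 then show ?thesis
      by (intro shared[of a b a b]) (auto simp: hex_lattice_edge_iff)
  qed
qed

text \<open>The hexagons form a triangular lattice, where max(|a|, |b|, |a + b|) is the distance of
  (a, b) from the origin: each of the six steps changes it by at most 1, and away from the origin
  some step lowers it.\<close>

lemma hexagons_within_eq:
  "hexagons_within n = {(a, b). \<bar>a\<bar> \<le> int n \<and> \<bar>b\<bar> \<le> int n \<and> \<bar>a + b\<bar> \<le> int n}"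
proof (induction n)
  case 0
  show ?case by auto
next
  case (Suc n)
  let ?B = "\<lambda>n a b. \<bar>a\<bar> \<le> int n \<and> \<bar>b\<bar> \<le> int n \<and> \<bar>a + b\<bar> \<le> int n"
  have "(c, d) \<in> hexagons_within (Suc n) \<longleftrightarrow> ?B (Suc n) c d" for c d
  proof -
    let ?D = "{(1, 0), (- 1, 0), (0, 1), (0, - 1), (1, - 1), (- 1, 1)} :: (int \<times> int) set"
    have "(c, d) \<in> hexagons_within (Suc n) \<longleftrightarrow>
        ?B n c d \<or> (\<exists>a b. ?B n a b \<and> (c - a, d - b) \<in> ?D)"
      unfolding hexagons_within.simps Suc.IH neighbouring_hexagons_iff[symmetric] by auto
    also have "(\<exists>a b. ?B n a b \<and> (c - a, d - b) \<in> ?D) \<longleftrightarrow> (\<exists>(i, j)\<in>?D. ?B n (c - i) (d - j))"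
    proof
      assume "\<exists>a b. ?B n a b \<and> (c - a, d - b) \<in> ?D"
      then obtain a b where "?B n a b" "(c - a, d - b) \<in> ?D" by blast
      then show "\<exists>(i, j)\<in>?D. ?B n (c - i) (d - j)"
        by (intro bexI[of _ "(c - a, d - b)"]) simp_all
    next
      assume "\<exists>(i, j)\<in>?D. ?B n (c - i) (d - j)"
      then obtain i j where "(i, j) \<in> ?D" "?B n (c - i) (d - j)" by blast
      then show "\<exists>a b. ?B n a b \<and> (c - a, d - b) \<in> ?D"
        by (intro exI[of _ "c - i"] exI[of _ "d - j"]) simp
    qed
    also have "?B n c d \<or> \<dots> \<longleftrightarrow> ?B (Suc n) c d"
    proof
      assume B: "?B (Suc n) c d"
      \<comment> \<open>For opposite signs, c + d lies strictly between c and d. Then subtracting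
        (1, -1) or (-1, 1) shrinks |c| and |d| and keeps c + d. In the other cases it is enough to
        move one coordinate towards 0.\<close>
      have opposite: "\<bar>c + d\<bar> \<le> int n" if "c > 0 \<and> d < 0 \<or> c < 0 \<and> d > 0"
        using B that by auto
      consider "c > 0" "d < 0" | "c < 0" "d > 0" | "c > 0" "d \<ge> 0" | "c = 0" "d > 0"
        | "c < 0" "d \<le> 0" | "c = 0" "d < 0" | "c = 0" "d = 0" by linarith
      then show "?B n c d \<or> (\<exists>(i, j)\<in>?D. ?B n (c - i) (d - j))"
        by cases (use B opposite in simp_all)
    qed auto
    finally show ?thesis .
  qed
  then show ?case by auto
qed

section \<open>Vertices, degrees, radial edges and counting in the nanosheet\<close>

lemma nbrs_nanosheet_subset: "nbrs (nanosheet r) v \<subseteq> verts (nanosheet r)"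
  unfolding nbrs_def nanosheet_def hexagon_edges_def by auto

lemma nanosheet_edge_bipartite:
  assumes "{u, v} \<in> edges (nanosheet r)"
  shows "snd (snd u) \<noteq> snd (snd v)"
  using assms unfolding nanosheet_def hexagon_edges_def hex_lattice_def
  by (auto simp: doubleton_eq_iff)

context
  fixes r :: nat
  assumes r: "r \<ge> 1"
begin

text \<open>The bounds become symmetric in the coordinates \<open>(a - 1, b, - a - b)\<close>, with sum \<open>- 1\<close>, of
  \<open>(a, b, False)\<close> and \<open>(a, b + 1, - a - b)\<close>, with sum \<open>1\<close>, of \<open>(a, b, True)\<close>. The neighbours of
  \<open>p\<close> are then obtained by incrementing two of its three coordinates.\<close>

lemma False_in_nanosheet_iff:
  "(a, b, False) \<in> verts (nanosheet r) \<longleftrightarrow>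
     - int r \<le> a - 1 \<and> a - 1 < int r \<and> - int r \<le> b \<and> b < int r \<and>
     - int r \<le> - a - b \<and> - a - b < int r"
proof -
  have "(a, b, False) \<in> verts (nanosheet r) \<longleftrightarrow>
      (a, b) \<in> hexagons_within (r - 1) \<or> (a - 1, b) \<in> hexagons_within (r - 1) \<or>
      (a - 1, b + 1) \<in> hexagons_within (r - 1)"
  proof -
    have "(a, b, False) \<in> hexagon_verts h \<longleftrightarrow> h \<in> {(a, b), (a - 1, b), (a - 1, b + 1)}" for h
      by (cases h) auto
    then show ?thesis unfolding nanosheet_def by auto
  qed
  \<comment> \<open>The three hexagons arise from \<open>p\<close> by adding 1 to one coordinate,
    which makes the sum 0. As \<open>p\<close> has sum -1 and r >= 1, at most one coordinate within
    the bounds is -r. Raising this one, or else any negative one, yields a hexagon of the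
    sheet.\<close>
  also have "\<dots> \<longleftrightarrow> - int r \<le> a - 1 \<and> a - 1 < int r \<and> - int r \<le> b \<and> b < int r \<and>
     - int r \<le> - a - b \<and> - a - b < int r"
    using r by (simp add: hexagons_within_eq of_nat_diff) smt
  finally show ?thesis .
qed

lemma True_in_nanosheet_iff:
  "(a, b, True) \<in> verts (nanosheet r) \<longleftrightarrow>
     - int r < a \<and> a \<le> int r \<and> - int r < b + 1 \<and> b + 1 \<le> int r \<and>
     - int r < - a - b \<and> - a - b \<le> int r"
proof -
  have "(a, b, True) \<in> verts (nanosheet r) \<longleftrightarrow>
      (a, b) \<in> hexagons_within (r - 1) \<or> (a - 1, b + 1) \<in> hexagons_within (r - 1) \<or>
      (a, b + 1) \<in> hexagons_within (r - 1)"
  proof -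
    have "(a, b, True) \<in> hexagon_verts h \<longleftrightarrow> h \<in> {(a, b), (a - 1, b + 1), (a, b + 1)}" for h
      by (cases h) auto
    then show ?thesis unfolding nanosheet_def by auto
  qed
  also have "\<dots> \<longleftrightarrow> - int r < a \<and> a \<le> int r \<and> - int r < b + 1 \<and> b + 1 \<le> int r \<and>
     - int r < - a - b \<and> - a - b \<le> int r"
    using r by (simp add: hexagons_within_eq of_nat_diff) smt
  finally show ?thesis .
qed

text \<open>A lattice edge lies on exactly two hexagons, collected in \<open>?I\<close>. Its ends
  might belong to the sheet through other hexagons only, but the coordinate bounds force one of
  these two into the sheet. So the sheet is an induced subgraph of the lattice.\<close>

lemma nanosheet_edge_iff:
  "{(x, y, True), (a, b, False)} \<in> edges (nanosheet r) \<longleftrightarrow>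
     (x, y, True) \<in> verts (nanosheet r) \<and> (a, b, False) \<in> verts (nanosheet r) \<and>
     (x, y) \<in> {(a, b), (a - 1, b), (a, b - 1)}"
proof -
  have both: "{(x, y, True), (a, b, False)} \<subseteq> hexagon_verts h \<longleftrightarrow>
      h \<in> {(a, b), (a - 1, b), (a - 1, b + 1)} \<inter> {(x, y), (x - 1, y + 1), (x, y + 1)}" for h
    by (cases h) auto
  let ?S = "hexagons_within (r - 1)"
  let ?I = "{(a, b), (a - 1, b), (a - 1, b + 1)} \<inter> {(x, y), (x - 1, y + 1), (x, y + 1)}"
  have edge: "{(x, y, True), (a, b, False)} \<in> edges (nanosheet r) \<longleftrightarrow>
     (x, y) \<in> {(a, b), (a - 1, b), (a, b - 1)} \<and> ?S \<inter> ?I \<noteq> {}"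
    unfolding nanosheet_def hexagon_edges_def using hex_lattice_edge_iff both by auto
  have S: "(c, d) \<in> ?S \<longleftrightarrow> \<bar>c\<bar> \<le> int r - 1 \<and> \<bar>d\<bar> \<le> int r - 1 \<and> \<bar>c + d\<bar> \<le> int r - 1" for c d
    using r by (simp add: hexagons_within_eq of_nat_diff)
  have "?S \<inter> ?I \<noteq> {} \<longleftrightarrow> (x, y, True) \<in> verts (nanosheet r) \<and> (a, b, False) \<in> verts (nanosheet r)"
    if "(x, y) \<in> {(a, b), (a - 1, b), (a, b - 1)}"
  proof -
    from that consider "x = a" "y = b" | "x = a - 1" "y = b" | "x = a" "y = b - 1" by auto
    then show ?thesis
    proof cases
      case 1
      have I: "?I = {(a, b), (a - 1, b + 1)}" by (simp add: 1 Int_insert_left)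
      have "?S \<inter> ?I \<noteq> {} \<longleftrightarrow> (a, b) \<in> ?S \<or> (a - 1, b + 1) \<in> ?S"
        unfolding I by blast
      then show ?thesis
        unfolding 1 False_in_nanosheet_iff True_in_nanosheet_iff S using r by smt
    next
      case 2
      have I: "?I = {(a - 1, b), (a - 1, b + 1)}" by (simp add: 2 Int_insert_left)
      have "?S \<inter> ?I \<noteq> {} \<longleftrightarrow> (a - 1, b) \<in> ?S \<or> (a - 1, b + 1) \<in> ?S"
        unfolding I by blast
      then show ?thesis
        unfolding 2 False_in_nanosheet_iff True_in_nanosheet_iff S using r by smt
    next
      case 3
      have I: "?I = {(a, b), (a - 1, b)}" by (simp add: 3 Int_insert_left)
      have "?S \<inter> ?I \<noteq> {} \<longleftrightarrow> (a, b) \<in> ?S \<or> (a - 1, b) \<in> ?S"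
        unfolding I by blast
      then show ?thesis
        unfolding 3 False_in_nanosheet_iff True_in_nanosheet_iff S using r by smt
    qed
  qed
  then show ?thesis unfolding edge by blast
qed

lemma nbrs_nanosheet_False:
  assumes "(a, b, False) \<in> verts (nanosheet r)"
  shows "nbrs (nanosheet r) (a, b, False) =
    {v \<in> {(a, b, True), (a - 1, b, True), (a, b - 1, True)}. v \<in> verts (nanosheet r)}"
proof -
  have "v \<in> nbrs (nanosheet r) (a, b, False) \<longleftrightarrow>
    v \<in> {v \<in> {(a, b, True), (a - 1, b, True), (a, b - 1, True)}. v \<in> verts (nanosheet r)}" for v
  proof (cases v)
    case (fields x y t)
    then show ?thesis
      using nanosheet_edge_iff[of x y a b] nanosheet_edge_bipartite[of "(a, b, False)" v r] assms
      by (cases t) (auto simp: nbrs_def insert_commute)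
  qed
  then show ?thesis by blast
qed

lemma nbrs_nanosheet_True:
  assumes "(a, b, True) \<in> verts (nanosheet r)"
  shows "nbrs (nanosheet r) (a, b, True) =
    {v \<in> {(a, b, False), (a + 1, b, False), (a, b + 1, False)}. v \<in> verts (nanosheet r)}"
proof -
  have "v \<in> nbrs (nanosheet r) (a, b, True) \<longleftrightarrow>
    v \<in> {v \<in> {(a, b, False), (a + 1, b, False), (a, b + 1, False)}. v \<in> verts (nanosheet r)}" for v
  proof (cases v)
    case (fields x y t)
    then show ?thesis
      using nanosheet_edge_iff[of a b x y] nanosheet_edge_bipartite[of "(a, b, True)" v r] assms
      by (cases t) (auto simp: nbrs_def)
  qed
  then show ?thesis by blast
qed

text \<open>The neighbour that keeps a coordinate of \<open>p\<close> and raises the other two lies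
  outside the sheet exactly if the kept coordinate is -r, and at most one coordinate is. For
  \<open>True\<close> the same works with lowering and r.\<close>

lemma degree_nanosheet_False:
  assumes "(a, b, False) \<in> verts (nanosheet r)"
  shows "degree (nanosheet r) (a, b, False) =
    (if a - 1 = - int r \<or> b = - int r \<or> - a - b = - int r then 2 else 3)"
proof -
  consider "a - 1 = - int r" | "b = - int r" | "- a - b = - int r"
    | "a - 1 \<noteq> - int r" "b \<noteq> - int r" "- a - b \<noteq> - int r" by blast
  then show ?thesis
  proof cases
    case 1
    then have "nbrs (nanosheet r) (a, b, False) = {(a, b, True), (a, b - 1, True)}"
      using assms r unfolding nbrs_nanosheet_False[OF assms]
      by (auto simp: False_in_nanosheet_iff True_in_nanosheet_iff)
    then show ?thesis using 1 by (simp add: degree_def)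
  next
    case 2
    then have "nbrs (nanosheet r) (a, b, False) = {(a, b, True), (a - 1, b, True)}"
      using assms r unfolding nbrs_nanosheet_False[OF assms]
      by (auto simp: False_in_nanosheet_iff True_in_nanosheet_iff)
    then show ?thesis using 2 by (simp add: degree_def)
  next
    case 3
    then have "nbrs (nanosheet r) (a, b, False) = {(a - 1, b, True), (a, b - 1, True)}"
      using assms r unfolding nbrs_nanosheet_False[OF assms]
      by (auto simp: False_in_nanosheet_iff True_in_nanosheet_iff)
    then show ?thesis using 3 by (simp add: degree_def)
  next
    case 4
    then have "nbrs (nanosheet r) (a, b, False) = {(a, b, True), (a - 1, b, True), (a, b - 1, True)}"
      using assms r unfolding nbrs_nanosheet_False[OF assms]
      by (auto simp: False_in_nanosheet_iff True_in_nanosheet_iff)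
    then show ?thesis using 4 by (simp add: degree_def)
  qed
qed

lemma degree_nanosheet_True:
  assumes "(a, b, True) \<in> verts (nanosheet r)"
  shows "degree (nanosheet r) (a, b, True) =
    (if a = int r \<or> b + 1 = int r \<or> - a - b = int r then 2 else 3)"
proof -
  consider "a = int r" | "b + 1 = int r" | "- a - b = int r"
    | "a \<noteq> int r" "b + 1 \<noteq> int r" "- a - b \<noteq> int r" by blast
  then show ?thesis
  proof cases
    case 1
    then have "nbrs (nanosheet r) (a, b, True) = {(a, b, False), (a, b + 1, False)}"
      using assms r unfolding nbrs_nanosheet_True[OF assms]
      by (auto simp: False_in_nanosheet_iff True_in_nanosheet_iff)
    then show ?thesis using 1 by (simp add: degree_def)
  next
    case 2
    then have "nbrs (nanosheet r) (a, b, True) = {(a, b, False), (a + 1, b, False)}"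
      using assms r unfolding nbrs_nanosheet_True[OF assms]
      by (auto simp: False_in_nanosheet_iff True_in_nanosheet_iff)
    then show ?thesis using 2 by (simp add: degree_def)
  next
    case 3
    then have "nbrs (nanosheet r) (a, b, True) = {(a + 1, b, False), (a, b + 1, False)}"
      using assms r unfolding nbrs_nanosheet_True[OF assms]
      by (auto simp: False_in_nanosheet_iff True_in_nanosheet_iff)
    then show ?thesis using 3 by (simp add: degree_def)
  next
    case 4
    then have "nbrs (nanosheet r) (a, b, True) = {(a, b, False), (a + 1, b, False), (a, b + 1, False)}"
      using assms r unfolding nbrs_nanosheet_True[OF assms]
      by (auto simp: False_in_nanosheet_iff True_in_nanosheet_iff)
    then show ?thesis using 4 by (simp add: degree_def)
  qed
qed

lemma degree_nanosheet:
  "v \<in> verts (nanosheet r) \<Longrightarrow> degree (nanosheet r) v \<in> {2, 3}"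
  by (cases v; cases "snd (snd v)") (auto simp: degree_nanosheet_False degree_nanosheet_True)

end

text \<open>The radial edge at \<open>p = (a - 1, b, - a - b)\<close> keeps the one coordinate that differs from the
  two others in being nonnegative. It can be read off the other end, where it is the one coordinate
  that differs from the two others in being positive.\<close>

fun spoke :: "hex_vertex \<Rightarrow> hex_vertex" where
  "spoke (a, b, _) =
     (if (b \<ge> 0) = (- a - b \<ge> 0) then (a - 1, b, True)
      else if (a - 1 \<ge> 0) = (- a - b \<ge> 0) then (a, b - 1, True)
      else (a, b, True))"

text \<open>At degree 3 no coordinate of \<open>p\<close> is -r. If the two raised coordinates are
  negative, they end up at most 0. If they are nonnegative, the kept one is at least 1 - r, so
  before raising they add up to at most r - 2. Either way no coordinate reaches r, so the other end
  has degree 3 as well.\<close>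

lemma spoke:
  assumes "r \<ge> 1" "v \<in> verts (nanosheet r)" "\<not> snd (snd v)" "degree (nanosheet r) v = 3"
  shows "{v, spoke v} \<in> edges (nanosheet r)" "snd (snd (spoke v))"
    "spoke v \<in> verts (nanosheet r)" "degree (nanosheet r) (spoke v) = 3"
proof -
  obtain a b where v: "v = (a, b, False)" using assms(3) by (cases v) auto
  note bounds = assms(2,4)[unfolded v False_in_nanosheet_iff[OF assms(1)]
      degree_nanosheet_False[OF assms(1) assms(2)[unfolded v]]]
  show T: "snd (snd (spoke v))" by (simp add: v)
  show V: "spoke v \<in> verts (nanosheet r)"
    using bounds by (auto simp: v True_in_nanosheet_iff[OF assms(1)] split: if_splits)
  then show "{v, spoke v} \<in> edges (nanosheet r)"
    using assms(2) nanosheet_edge_iff[OF assms(1), of _ _ a b]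
    by (subst insert_commute) (auto simp: v)
  obtain x y where xy: "spoke v = (x, y, True)" using T by (cases "spoke v") auto
  have "x \<noteq> int r \<and> y + 1 \<noteq> int r \<and> - x - y \<noteq> int r"
    using xy bounds by (auto simp: v split: if_splits)
  then show "degree (nanosheet r) (spoke v) = 3"
    using V degree_nanosheet_True[OF assms(1), of x y] by (simp add: xy)
qed

lemma inj_on_spoke: "inj_on spoke {v. \<not> snd (snd v)}"
proof (rule inj_onI)
  fix u v assume uv: "u \<in> {v. \<not> snd (snd v)}" "v \<in> {v. \<not> snd (snd v)}" "spoke u = spoke v"
  obtain a b c d where "u = (a, b, False)" "v = (c, d, False)"
    using uv(1,2) by (cases u; cases v) auto
  then show "u = v" using uv(3) by (auto split: if_splits)
qed

text \<open>The sum -1 forbids equal signs of all coordinates of \<open>p\<close>. Hence, in cyclic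
  order, exactly one nonnegative coordinate is followed by a negative one. Its position selects one
  of three rhombi of r * r vertices: these two coordinates are free, and the third is then within
  its bounds.\<close>

lemma card_nanosheet_False:
  assumes "r \<ge> 1"
  shows "card {v \<in> verts (nanosheet r). \<not> snd (snd v)} = 3 * r\<^sup>2"
proof -
  let ?R = "{0..<int r} \<times> {- int r..<0}"
  let ?f1 = "\<lambda>(x, y). (x + 1, y, False) :: hex_vertex"
  let ?f2 = "\<lambda>(x, y). (- x - y, x, False) :: hex_vertex"
  let ?f3 = "\<lambda>(x, y). (y + 1, - 1 - x - y, False) :: hex_vertex"
  have split: "{v \<in> verts (nanosheet r). \<not> snd (snd v)} = ?f1 ` ?R \<union> ?f2 ` ?R \<union> ?f3 ` ?R"
  proof (intro equalityI subsetI)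
    fix v assume v: "v \<in> {v \<in> verts (nanosheet r). \<not> snd (snd v)}"
    then obtain a b where ab: "v = (a, b, False)" by (cases v) auto
    have "v = ?f1 (a - 1, b)" "v = ?f2 (b, - a - b)" "v = ?f3 (- a - b, a - 1)"
      using ab by auto
    moreover have "(a - 1, b) \<in> ?R \<or> (b, - a - b) \<in> ?R \<or> (- a - b, a - 1) \<in> ?R"
      using v by (auto simp: ab False_in_nanosheet_iff[OF assms])
    ultimately show "v \<in> ?f1 ` ?R \<union> ?f2 ` ?R \<union> ?f3 ` ?R" by blast
  next
    fix v assume "v \<in> ?f1 ` ?R \<union> ?f2 ` ?R \<union> ?f3 ` ?R"
    then show "v \<in> {v \<in> verts (nanosheet r). \<not> snd (snd v)}"
      by (auto simp: False_in_nanosheet_iff[OF assms])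
  qed
  have "inj_on ?f1 ?R" "inj_on ?f2 ?R" "inj_on ?f3 ?R" by (auto simp: inj_on_def)
  then have c: "card (?f1 ` ?R) = r * r" "card (?f2 ` ?R) = r * r" "card (?f3 ` ?R) = r * r"
    by (simp_all add: card_image card_cartesian_product)
  have "?f1 ` ?R \<inter> ?f2 ` ?R = {}" "(?f1 ` ?R \<union> ?f2 ` ?R) \<inter> ?f3 ` ?R = {}" by auto
  then show ?thesis unfolding split by (simp add: card_Un_disjoint c power2_eq_square)
qed

text \<open>Exactly one of the coordinates a, b + 1, -a - b equals r. The other two exceed -r and
  have sum 1 - r, so one of them ranges over the r values in \<open>?R\<close> and determines the
  other.\<close>

lemma card_nanosheet_True_degree_2:
  assumes "r \<ge> 1"
  shows "card {v \<in> verts (nanosheet r). snd (snd v) \<and> degree (nanosheet r) v = 2} = 3 * r"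
proof -
  let ?R = "{- int r<..0}"
  let ?f1 = "\<lambda>x. (int r, x - 1, True) :: hex_vertex"
  let ?f2 = "\<lambda>x. (x, int r - 1, True) :: hex_vertex"
  let ?f3 = "\<lambda>x. (x, - int r - x, True) :: hex_vertex"
  have split: "{v \<in> verts (nanosheet r). snd (snd v) \<and> degree (nanosheet r) v = 2} =
    ?f1 ` ?R \<union> ?f2 ` ?R \<union> ?f3 ` ?R"
  proof (intro equalityI subsetI)
    fix v assume v: "v \<in> {v \<in> verts (nanosheet r). snd (snd v) \<and> degree (nanosheet r) v = 2}"
    then obtain a b where ab: "v = (a, b, True)" by (cases v) auto
    have bounds: "- int r < a" "a \<le> int r" "- int r < b + 1" "b + 1 \<le> int r"
        "- int r < - a - b" "- a - b \<le> int r"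
      using v ab True_in_nanosheet_iff[OF assms, of a b] by auto
    from v have "a = int r \<or> b + 1 = int r \<or> - a - b = int r"
      by (auto simp: ab degree_nanosheet_True[OF assms] split: if_splits)
    then consider "a = int r" | "b = int r - 1" | "b = - int r - a" by linarith
    then have "v = ?f1 (b + 1) \<and> b + 1 \<in> ?R \<or> v = ?f2 a \<and> a \<in> ?R \<or> v = ?f3 a \<and> a \<in> ?R"
      by cases (use bounds ab in simp_all)
    then show "v \<in> ?f1 ` ?R \<union> ?f2 ` ?R \<union> ?f3 ` ?R" by blast
  next
    fix v assume "v \<in> ?f1 ` ?R \<union> ?f2 ` ?R \<union> ?f3 ` ?R"
    moreover from this have "v \<in> verts (nanosheet r)"
      using assms by (auto simp: True_in_nanosheet_iff[OF assms])
    ultimately show "v \<in> {v \<in> verts (nanosheet r). snd (snd v) \<and> degree (nanosheet r) v = 2}"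
      by (auto simp: degree_nanosheet_True[OF assms])
  qed
  have "inj_on ?f1 ?R" "inj_on ?f2 ?R" "inj_on ?f3 ?R" by (auto simp: inj_on_def)
  then have c: "card (?f1 ` ?R) = r" "card (?f2 ` ?R) = r" "card (?f3 ` ?R) = r"
    by (simp_all add: card_image)
  have "?f1 ` ?R \<inter> ?f2 ` ?R = {}" "(?f1 ` ?R \<union> ?f2 ` ?R) \<inter> ?f3 ` ?R = {}"
    using assms by auto
  then show ?thesis unfolding split by (simp add: card_Un_disjoint c)
qed

section \<open>Geodesics in a silicate sheet\<close>

lemma is_path_singleton: "is_path G [x] \<longleftrightarrow> x \<in> verts G"
  by (simp add: is_path_def)

lemma is_path_Cons_Cons:
  "is_path G (x # y # zs) \<longleftrightarrow>
     x \<in> verts G \<and> x \<notin> set (y # zs) \<and> {x, y} \<in> edges G \<and> is_path G (y # zs)"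
  unfolding is_path_def by (auto simp: nth_Cons split: nat.splits)

lemmas is_path_simps = is_path_singleton is_path_Cons_Cons

lemma is_path_append_edge:
  assumes "is_path G (xs @ ys)" "xs \<noteq> []" "ys \<noteq> []"
  shows "{last xs, hd ys} \<in> edges G"
proof -
  have "Suc (length xs - 1) < length (xs @ ys)" using assms(2,3) by (cases xs; cases ys) auto
  then have "{(xs @ ys) ! (length xs - 1), (xs @ ys) ! Suc (length xs - 1)} \<in> edges G"
    using assms(1) unfolding is_path_def by blast
  then show ?thesis using assms(2,3)
    by (simp add: nth_append last_conv_nth hd_conv_nth)
qed

lemma nbrs_sym: "u \<in> nbrs G v \<longleftrightarrow> v \<in> nbrs G u"
  by (simp add: nbrs_def insert_commute)

lemma edge_iff_nbrs: "{u, v} \<in> edges G \<longleftrightarrow> v \<in> nbrs G u"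
  by (simp add: nbrs_def)

text \<open>A longer path would leave an end of \<open>p\<close> through the only neighbour of that
  end, but \<open>p\<close> has an edge there and thus contains this neighbour already.\<close>

lemma maximal_geodesic_if_ends_pendant:
  assumes "geodesic G p" "length p \<ge> 2" "nbrs G (hd p) = {s}" "nbrs G (last p) = {t}"
  shows "maximal_geodesic G p"
  unfolding maximal_geodesic_def
proof (intro conjI notI)
  assume "\<exists>q. geodesic G q \<and> strict_sublist p q"
  then obtain q where q: "is_path G q" and "strict_sublist p q"
    unfolding geodesic_def by blast
  then obtain xs ys where xys: "q = xs @ p @ ys" and "p \<noteq> q"
    unfolding strict_sublist_def sublist_def by blast
  then have ne: "xs \<noteq> [] \<or> ys \<noteq> []" by auto
  have d: "distinct (xs @ p @ ys)" using q xys by (simp add: is_path_def)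
  obtain a p1 where p1: "p = a # p1" "p1 \<noteq> []" using assms(2)
    by (cases p) (auto simp: Suc_le_length_iff)
  then obtain p2 where p2: "p = p2 @ [last p]" "p2 \<noteq> []"
    by (metis append_butlast_last_id butlast.simps(2) list.discI)
  show False
  proof (cases "xs = []")
    case False
    have "{last xs, hd p} \<in> edges G"
      using is_path_append_edge[of G xs "p @ ys"] q xys False p1 by simp
    moreover have "{hd p, hd p1} \<in> edges G"
      using is_path_append_edge[of G "xs @ [a]" "p1 @ ys"] q xys p1 by simp
    ultimately have "last xs = hd p1"
      using assms(3) nbrs_sym[of "last xs"] by (auto simp: edge_iff_nbrs)
    moreover have "last xs \<in> set xs" "hd p1 \<in> set p" using False p1 by auto
    ultimately show False using d by auto
  next
    case True
    then have ys: "ys \<noteq> []" using ne by simp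
    have "{last p, hd ys} \<in> edges G"
      using is_path_append_edge[of G "xs @ p" ys] q xys ys p1 by simp
    moreover have "{last p2, last p} \<in> edges G"
      using is_path_append_edge[of G "xs @ p2" "[last p] @ ys"] q xys p2
      by (metis append.assoc append_Cons append_is_Nil_conv last_append list.discI list.sel(1))
    ultimately have "hd ys = last p2"
      using assms(4) nbrs_sym[of "last p" G "last p2"] by (auto simp: edge_iff_nbrs)
    moreover have "hd ys \<in> set ys" "last p2 \<in> set p"
      using ys p2 by (auto, metis in_set_butlastD last_in_set butlast_snoc)
    ultimately show False using d by auto
  qed
qed (fact assms(1))

lemma geodesic_if_length_ge:
  assumes "is_path G p" "\<And>q. is_path G q \<Longrightarrow> hd q = hd p \<Longrightarrow> last q = last p \<Longrightarrow> length p \<le> length q"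
  shows "geodesic G p"
  using assms unfolding geodesic_def by blast

lemma not_maximal_geodesic_Cons:
  assumes "geodesic G (x # p)" shows "\<not> maximal_geodesic G p"
proof -
  have "strict_sublist p (x # p)"
    unfolding strict_sublist_def by (auto simp: sublist_Cons_right)
  then show ?thesis using assms unfolding maximal_geodesic_def by blast
qed

lemma not_maximal_geodesic_snoc:
  assumes "geodesic G (p @ [x])" shows "\<not> maximal_geodesic G p"
proof -
  have "strict_sublist p (p @ [x])"
    unfolding strict_sublist_def by auto
  then show ?thesis using assms unfolding maximal_geodesic_def by blast
qed

lemma geodesic_three:
  assumes "is_path G [x, y, z]" "{x, z} \<notin> edges G"
  shows "geodesic G [x, y, z]"
proof (rule geodesic_if_length_ge[OF assms(1)])
  fix q assume q: "is_path G q" "hd q = hd [x, y, z]" "last q = last [x, y, z]"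
  have "x \<noteq> z" using assms(1) by (simp add: is_path_simps)
  show "length [x, y, z] \<le> length q"
  proof (rule ccontr)
    assume "\<not> ?thesis"
    then have "length q \<le> 2" by simp
    then consider "q = []" | u where "q = [u]" | u v where "q = [u, v]"
      by (metis One_nat_def Suc_1 le_SucE le_zero_eq length_0_conv length_Suc_conv)
    then show False
      using q assms \<open>x \<noteq> z\<close> by cases (auto simp: is_path_simps is_path_def)
  qed
qed

section \<open>Silicon and oxygen vertices\<close>

locale silicate =
  fixes H :: "'a ugraph" and Si Ox :: "'a set"
  assumes simple: "simple_graph H"
    and verts: "verts H = Si \<union> Ox" and disjoint: "Si \<inter> Ox = {}"
    and edge: "\<And>e. e \<in> edges H \<Longrightarrow> \<exists>s\<in>Si. \<exists>x\<in>Ox. e = {s, x}"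
    and card_nbrs_Si': "\<And>s. s \<in> Si \<Longrightarrow> card (nbrs H s \<inter> Ox) = 4"
    and card_nbrs_Ox': "\<And>x. x \<in> Ox \<Longrightarrow> card (nbrs H x \<inter> Si) \<in> {1, 2}"
    and card_common: "\<And>s t. s \<in> Si \<Longrightarrow> t \<in> Si \<Longrightarrow> s \<noteq> t \<Longrightarrow>
      card (nbrs H s \<inter> nbrs H t \<inter> Ox) \<le> 1"
begin

lemma edge_sides: "{u, v} \<in> edges H \<Longrightarrow> (u \<in> Si \<and> v \<in> Ox) \<or> (u \<in> Ox \<and> v \<in> Si)"
  using edge by (fastforce simp: doubleton_eq_iff)

lemma nbrs_Si: "s \<in> Si \<Longrightarrow> nbrs H s \<subseteq> Ox"
  using edge_sides[of s] disjoint by (auto simp: nbrs_def)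

lemma nbrs_Ox: "x \<in> Ox \<Longrightarrow> nbrs H x \<subseteq> Si"
  using edge_sides[of x] disjoint by (auto simp: nbrs_def)

lemma card_nbrs_Si: "s \<in> Si \<Longrightarrow> card (nbrs H s) = 4"
  using card_nbrs_Si' nbrs_Si by (metis inf.absorb1)

lemma card_nbrs_Ox: "x \<in> Ox \<Longrightarrow> card (nbrs H x) \<in> {1, 2}"
  using card_nbrs_Ox' nbrs_Ox by (metis inf.absorb1)

lemma finite_verts: "finite Si" "finite Ox"
  using simple verts by (simp_all add: simple_graph_def)

lemma finite_nbrs: "v \<in> verts H \<Longrightarrow> finite (nbrs H v)"
  using nbrs_Si[of v] nbrs_Ox[of v] finite_verts verts by (auto intro: finite_subset)

lemma common_unique:
  assumes "s \<noteq> t" "s \<in> Si" "t \<in> Si" "x \<in> nbrs H s" "x \<in> nbrs H t" "y \<in> nbrs H s" "y \<in> nbrs H t"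
  shows "x = y"
proof -
  have "finite (nbrs H s \<inter> nbrs H t \<inter> Ox)" using finite_verts by blast
  moreover have "x \<in> nbrs H s \<inter> nbrs H t \<inter> Ox" "y \<in> nbrs H s \<inter> nbrs H t \<inter> Ox"
    using assms nbrs_Si by auto
  ultimately show ?thesis
    using card_common[of s t] assms(1-3) by (metis One_nat_def card_le_Suc0_iff_eq)
qed

section \<open>Bridging and pendant oxygen vertices, and smoothing\<close>

definition bridges :: "'a set" where "bridges = {v \<in> verts H. degree H v = 2}"

definition pend :: "'a \<Rightarrow> 'a set" where "pend s = {x \<in> nbrs H s. nbrs H x = {s}}"

text \<open>Anticipates the edges left after smoothing and deleting pendant vertices, see
  \<open>delete_pendant_SM\<close>.\<close>

definition joined :: "'a \<Rightarrow> 'a \<Rightarrow> bool" where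
  "joined s t \<longleftrightarrow> s \<in> Si \<and> t \<in> Si \<and> s \<noteq> t \<and> nbrs H s \<inter> nbrs H t \<noteq> {}"

lemma finite_pend: "s \<in> Si \<Longrightarrow> finite (pend s)"
  using finite_nbrs[of s] verts by (simp add: pend_def)

lemma bridges_subset: "bridges \<subseteq> Ox"
  using card_nbrs_Si verts by (force simp: bridges_def degree_def)

lemma nbrs_cases:
  assumes "s \<in> Si" "x \<in> nbrs H s"
  obtains "x \<in> pend s" "x \<notin> bridges" "x \<in> Ox"
  | t where "joined s t" "nbrs H x = {s, t}" "x \<in> bridges" "x \<in> Ox"
proof -
  have x: "x \<in> Ox" "s \<in> nbrs H x" using assms nbrs_Si nbrs_sym[of s H x] by auto
  show ?thesis
  proof (cases "card (nbrs H x) = 1")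
    case True
    then have "nbrs H x = {s}" using x(2) by (metis card_1_singletonE singletonD)
    then show ?thesis using that(1) x(1) assms True by (simp add: pend_def bridges_def degree_def)
  next
    case False
    then have 2: "card (nbrs H x) = 2" using card_nbrs_Ox x(1) by blast
    then obtain t where t: "nbrs H x = {s, t}" "t \<noteq> s"
      using x(2) by (auto simp: card_2_iff doubleton_eq_iff)
    then have "joined s t"
      using assms nbrs_Ox[OF x(1)] nbrs_sym[of t H x] by (auto simp: joined_def)
    then show ?thesis using that(2) t 2 x(1) verts by (simp add: bridges_def degree_def)
  qed
qed

lemma nbrs_common:
  assumes "joined s t" "x \<in> nbrs H s" "x \<in> nbrs H t"
  shows "x \<in> bridges" "nbrs H x = {s, t}"
proof -
  have st: "s \<in> Si" "s \<noteq> t" "t \<in> nbrs H x" using assms by (auto simp: joined_def nbrs_sym[of t])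
  have "x \<in> bridges \<and> nbrs H x = {s, t}"
    using st(1) assms(2)
  proof (cases rule: nbrs_cases)
    case 1
    then show ?thesis using st by (simp add: pend_def)
  next
    case (2 u)
    then show ?thesis using st by auto
  qed
  then show "x \<in> bridges" "nbrs H x = {s, t}" by auto
qed

text \<open>Closed form for smoothing the vertices of a set \<open>W\<close> of oxygen vertices one
  after the other. Once \<open>fold_smooth\<close> has shown the agreement, the order of smoothing
  is no longer an issue.\<close>

definition smoothed :: "'a set \<Rightarrow> 'a ugraph" where
  "smoothed W = \<lparr> verts = verts H - W,
     edges = {e \<in> edges H. e \<inter> W = {}} \<union>
       {{x, y} | x y. x \<noteq> y \<and> (\<exists>v\<in>W. x \<in> nbrs H v \<and> y \<in> nbrs H v)} \<rparr>"

text \<open>The edges added by smoothing join silicon vertices only, so an oxygen vertex still to be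
  smoothed keeps its neighbours.\<close>

lemma nbrs_smoothed_Ox:
  assumes "W \<subseteq> Ox" "v \<in> Ox - W"
  shows "nbrs (smoothed W) v = nbrs H v"
proof -
  have "x \<notin> W" if "x \<in> nbrs H v" for x
    using that assms nbrs_Ox disjoint by blast
  moreover have "v \<notin> nbrs H w" if "w \<in> W" for w
    using that assms nbrs_Ox disjoint by blast
  ultimately show ?thesis using assms(2)
    unfolding nbrs_def[of "smoothed W"] by (auto simp: smoothed_def nbrs_def doubleton_eq_iff)
qed

lemma fold_smooth:
  assumes "distinct vs" "set vs \<subseteq> Ox"
  shows "fold smooth vs H = smoothed (set vs)"
  using assms
\<comment> \<open>\<open>fold\<close> treats the last entry last, so entries are split off at the
  end to let the last smoothing act on the graph of the induction hypothesis.\<close>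
proof (induction vs rule: rev_induct)
  case Nil
  then show ?case by (simp add: smoothed_def)
next
  case (snoc v vs)
  let ?W = "set vs"
  have v: "v \<in> Ox - ?W" "?W \<subseteq> Ox" using snoc.prems by auto
  have "v \<notin> nbrs H w" if "w \<in> ?W" for w
    using that v nbrs_Ox disjoint by blast
  then have "{e \<in> edges (smoothed ?W). v \<notin> e} = {e \<in> edges H. e \<inter> insert v ?W = {}} \<union>
      {{x, y} | x y. x \<noteq> y \<and> (\<exists>v\<in>?W. x \<in> nbrs H v \<and> y \<in> nbrs H v)}"
    unfolding smoothed_def by auto
  moreover have "{{x, y} | x y. x \<noteq> y \<and> (\<exists>w\<in>insert v ?W. x \<in> nbrs H w \<and> y \<in> nbrs H w)} =
      {{x, y} | x y. x \<noteq> y \<and> (\<exists>w\<in>?W. x \<in> nbrs H w \<and> y \<in> nbrs H w)} \<union>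
      {{x, y} | x y. x \<in> nbrs H v \<and> y \<in> nbrs H v \<and> x \<noteq> y}" by blast
  moreover have "verts (smoothed ?W) - {v} = verts H - insert v ?W" by (auto simp: smoothed_def)
  ultimately have "smooth v (smoothed ?W) = smoothed (insert v ?W)"
    unfolding smooth_def nbrs_smoothed_Ox[OF v(2,1)] smoothed_def[of "insert v ?W"]
    by (simp only: Un_assoc)
  then show ?case using snoc by simp
qed

text \<open>Each of the four oxygen neighbours is pendant or a bridge, and the bridges correspond to
  the joined silicon vertices because two silicon vertices share at most one oxygen
  neighbour.\<close>

lemma card_pend_joined:
  assumes "s \<in> Si"
  shows "card (pend s) + card {t. joined s t} = 4"
proof -
  \<comment> \<open>The choice is unique: \<open>?g t\<close> is the one oxygen vertex between
    \<open>s\<close> and \<open>t\<close>.\<close>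
  let ?g = "\<lambda>t. SOME x. x \<in> nbrs H s \<inter> nbrs H t"
  have g: "?g t \<in> nbrs H s" "?g t \<in> nbrs H t" "?g t \<in> bridges" "nbrs H (?g t) = {s, t}"
    if "joined s t" for t
  proof -
    have *: "?g t \<in> nbrs H s \<inter> nbrs H t"
      using that unfolding joined_def by (intro someI_ex[of "\<lambda>x. x \<in> _"]) blast
    then show "?g t \<in> nbrs H s" "?g t \<in> nbrs H t" by auto
    then show "?g t \<in> bridges" "nbrs H (?g t) = {s, t}"
      using nbrs_common[OF that] by blast+
  qed
  have "inj_on ?g {t. joined s t}"
  proof (rule inj_onI)
    fix t u assume "t \<in> {t. joined s t}" "u \<in> {t. joined s t}" "?g t = ?g u"
    then have "{s, t} = {s, u}" "t \<noteq> s" "u \<noteq> s" using g(4)[of t] g(4)[of u] by (auto simp: joined_def)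
    then show "t = u" by (simp add: doubleton_eq_iff)
  qed
  moreover have "?g ` {t. joined s t} = nbrs H s \<inter> bridges"
  proof (intro equalityI subsetI)
    fix x assume x: "x \<in> nbrs H s \<inter> bridges"
    then obtain t where t: "joined s t" "nbrs H x = {s, t}"
      using nbrs_cases[OF assms, of x] by auto
    then have "x = ?g t"
      using common_unique[of s t x "?g t"] g[OF t(1)] x nbrs_sym[of t H x] by (auto simp: joined_def)
    then show "x \<in> ?g ` {t. joined s t}" using t(1) by blast
  qed (use g in auto)
  ultimately have "card {t. joined s t} = card (nbrs H s \<inter> bridges)"
    using card_image by fastforce
  moreover have "nbrs H s = pend s \<union> (nbrs H s \<inter> bridges)" "pend s \<inter> (nbrs H s \<inter> bridges) = {}"
    using assms nbrs_Si by (auto elim!: nbrs_cases simp: pend_def bridges_def degree_def)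
  moreover have "finite (nbrs H s)" using assms finite_nbrs verts by auto
  ultimately show ?thesis
    using card_Un_disjoint[of "pend s" "nbrs H s \<inter> bridges"] card_nbrs_Si[OF assms]
    by (metis finite_Un)
qed

lemma nbrs_smoothed_Si:
  assumes "s \<in> Si"
  shows "nbrs (smoothed bridges) s = pend s \<union> {t. joined s t}"
proof (intro equalityI subsetI)
  fix y assume "y \<in> nbrs (smoothed bridges) s"
  then consider "{s, y} \<in> edges H" "y \<notin> bridges"
    | v where "s \<noteq> y" "v \<in> bridges" "s \<in> nbrs H v" "y \<in> nbrs H v"
    unfolding nbrs_def[of "smoothed bridges"] by (auto simp: smoothed_def doubleton_eq_iff)
  then show "y \<in> pend s \<union> {t. joined s t}"
  proof cases
    case 1
    then show ?thesis using assms by (auto elim!: nbrs_cases simp: edge_iff_nbrs)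
  next
    case 2
    then have "y \<in> Si" using bridges_subset nbrs_Ox by blast
    then show ?thesis using 2 assms nbrs_sym[of s] nbrs_sym[of y] by (auto simp: joined_def)
  qed
next
  fix y assume y: "y \<in> pend s \<union> {t. joined s t}"
  show "y \<in> nbrs (smoothed bridges) s"
  proof (cases "joined s y")
    case True
    then obtain x where x: "x \<in> nbrs H s" "x \<in> nbrs H y" "s \<noteq> y" by (auto simp: joined_def)
    then have sy: "s \<in> nbrs H x" "y \<in> nbrs H x" by (simp_all add: nbrs_sym)
    have "x \<in> bridges" using nbrs_common True x by blast
    then show ?thesis using sy x(3)
      unfolding nbrs_def[of "smoothed bridges"] by (auto simp: smoothed_def)
  next
    case False
    then have "y \<in> pend s" using y by simp
    then have "y \<notin> bridges" "{s, y} \<in> edges H"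
      by (auto simp: pend_def bridges_def degree_def edge_iff_nbrs)
    moreover have "s \<notin> bridges" using assms bridges_subset disjoint by auto
    ultimately show ?thesis by (simp add: nbrs_def smoothed_def)
  qed
qed

text \<open>After smoothing, silicon vertices still have degree 4 by
  \<open>card_pend_joined\<close>, and the remaining oxygen vertices have degree 1. So exactly the
  oxygen is deleted, and only the edges that replaced bridges survive.\<close>

lemma delete_pendant_smoothed:
  "delete_pendant (smoothed bridges) = \<lparr> verts = Si, edges = {{s, t} | s t. joined s t} \<rparr>"
proof -
  have deg_Si: "degree (smoothed bridges) s = 4" if "s \<in> Si" for s
  proof -
    have "pend s \<subseteq> Ox" "{t. joined s t} \<subseteq> Si"
      using that nbrs_Si by (auto simp: pend_def joined_def)
    then have "card (pend s \<union> {t. joined s t}) = card (pend s) + card {t. joined s t}"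
      using finite_verts disjoint by (intro card_Un_disjoint) (auto intro: finite_subset)
    then show ?thesis using that card_pend_joined by (simp add: degree_def nbrs_smoothed_Si)
  qed
  have deg_Ox: "degree (smoothed bridges) x = 1" if "x \<in> Ox - bridges" for x
  proof -
    have "card (nbrs H x) = 1"
      using that card_nbrs_Ox[of x] verts by (auto simp: bridges_def degree_def)
    then show ?thesis by (simp add: degree_def nbrs_smoothed_Ox[OF bridges_subset that])
  qed
  have V: "{v \<in> verts (smoothed bridges). degree (smoothed bridges) v \<noteq> 1} = Si"
  proof -
    have "verts (smoothed bridges) = Si \<union> (Ox - bridges)"
      using bridges_subset disjoint verts by (auto simp: smoothed_def)
    then show ?thesis using deg_Si deg_Ox by auto
  qed
  have "{e \<in> edges (smoothed bridges). e \<subseteq> Si} = {{s, t} | s t. joined s t}"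
  proof (intro equalityI subsetI)
    fix e assume e: "e \<in> {e \<in> edges (smoothed bridges). e \<subseteq> Si}"
    moreover have "e \<notin> edges H" using e edge[of e] disjoint by auto
    ultimately obtain x y where xy: "e = {x, y}" by (auto simp: smoothed_def)
    then have "y \<in> nbrs (smoothed bridges) x" "x \<in> Si" "y \<in> Si" using e by (auto simp: nbrs_def)
    then have "joined x y"
      using nbrs_Si[of x] disjoint by (auto simp: nbrs_smoothed_Si pend_def)
    then show "e \<in> {{s, t} | s t. joined s t}" using xy by blast
  next
    fix e assume "e \<in> {{s, t} | s t. joined s t}"
    then obtain s t where "e = {s, t}" "joined s t" by blast
    moreover from this have "t \<in> nbrs (smoothed bridges) s" "s \<in> Si" "t \<in> Si"
      using nbrs_smoothed_Si[of s] by (auto simp: joined_def)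
    ultimately show "e \<in> {e \<in> edges (smoothed bridges). e \<subseteq> Si}" by (simp add: nbrs_def)
  qed
  then show ?thesis unfolding delete_pendant_def V by (simp add: Let_def)
qed

lemma delete_pendant_SM:
  assumes "is_SM H M"
  shows "delete_pendant M = \<lparr> verts = Si, edges = {{s, t} | s t. joined s t} \<rparr>"
proof -
  obtain vs where "distinct vs" "set vs = bridges" "M = fold smooth vs H"
    using assms unfolding is_SM_def bridges_def by blast
  then show ?thesis using fold_smooth[of vs] bridges_subset delete_pendant_smoothed by simp
qed

section \<open>Short geodesics and the shape of maximal ones\<close>

lemma nbrs_in_verts: "{u, v} \<in> edges H \<Longrightarrow> u \<in> verts H \<and> v \<in> verts H"
  using edge_sides verts by blast

lemma Ox_nonadjacent: "x \<in> Ox \<Longrightarrow> y \<in> Ox \<Longrightarrow> {x, y} \<notin> edges H"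
  using edge_sides disjoint by blast

lemma Si_nonadjacent: "x \<in> Si \<Longrightarrow> y \<in> Si \<Longrightarrow> {x, y} \<notin> edges H"
  using edge_sides disjoint by blast

lemma geodesic_two:
  assumes "{x, y} \<in> edges H"
  shows "geodesic H [x, y]"
proof (rule geodesic_if_length_ge)
  have "x \<noteq> y" using edge_sides[OF assms] disjoint by auto
  then show "is_path H [x, y]" using assms nbrs_in_verts[OF assms] by (simp add: is_path_simps)
  fix q assume "is_path H q" "hd q = hd [x, y]" "last q = last [x, y]"
  then show "length [x, y] \<le> length q"
    using \<open>x \<noteq> y\<close> by (cases q; cases "tl q") (auto simp: is_path_def)
qed

lemma geodesic_Ox_Si_Ox:
  assumes "s \<in> Si" "x \<in> nbrs H s" "y \<in> nbrs H s" "x \<noteq> y"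
  shows "geodesic H [x, s, y]"
proof (rule geodesic_three)
  have "x \<in> Ox" "y \<in> Ox" using assms nbrs_Si by auto
  then show "{x, y} \<notin> edges H" by (rule Ox_nonadjacent)
  show "is_path H [x, s, y]"
    using assms \<open>x \<in> Ox\<close> \<open>y \<in> Ox\<close> disjoint verts
    by (auto simp: is_path_simps nbrs_def insert_commute)
qed

text \<open>Paths alternate between the two sides, so one with ends on opposite sides has an even
  number of vertices, and two are excluded by nonadjacency.\<close>

lemma length_ge_4_if_Ox_Si:
  assumes q: "is_path H q" and "{hd q, last q} \<notin> edges H"
    and "hd q \<in> Ox \<and> last q \<in> Si \<or> hd q \<in> Si \<and> last q \<in> Ox"
  shows "length q \<ge> 4"
proof (rule ccontr)
  assume "\<not> length q \<ge> 4"
  then have "length q \<le> 3" by simp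
  then consider "q = []" | u where "q = [u]" | u v where "q = [u, v]" | u v w where "q = [u, v, w]"
    by (auto simp: le_Suc_eq numeral_3_eq_3 length_Suc_conv)
  then show False
  proof cases
    case 4
    then have "{u, v} \<in> edges H" "{v, w} \<in> edges H" using q by (simp_all add: is_path_simps)
    then show False using 4 assms(3) edge_sides disjoint by (metis disjoint_iff last.simps list.distinct(1) list.sel(1))
  qed (use assms disjoint in \<open>auto simp: is_path_simps is_path_def\<close>)
qed

text \<open>If \<open>x\<close> were adjacent to \<open>t\<close>, then \<open>x\<close> and
  \<open>y\<close> would be two common neighbours of \<open>s\<close> and \<open>t\<close>. Hence
  \<open>length_ge_4_if_Ox_Si\<close> applies to the ends \<open>x\<close> and
  \<open>t\<close>.\<close>

lemma geodesic_extend_bridge: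
  assumes "s \<in> Si" "x \<in> nbrs H s" "y \<in> nbrs H s" "x \<noteq> y" "nbrs H y = {s, t}" "s \<noteq> t" "t \<in> Si"
  shows "geodesic H [x, s, y, t]" "geodesic H [t, y, s, x]"
proof -
  have Ox: "x \<in> Ox" "y \<in> Ox" using assms nbrs_Si by auto
  have y: "y \<in> nbrs H t" using assms(5) by (simp add: nbrs_sym[of y])
  then have "x \<notin> nbrs H t"
    using common_unique[of s t x y] assms by blast
  then have nonadj: "{x, t} \<notin> edges H" "{t, x} \<notin> edges H"
    by (simp_all add: edge_iff_nbrs nbrs_sym[of t])
  have E: "{x, s} \<in> edges H" "{s, y} \<in> edges H" "{y, t} \<in> edges H" "{s, x} \<in> edges H" "{y, s} \<in> edges H" "{t, y} \<in> edges H"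
    using assms y by (auto simp: nbrs_def insert_commute)
  have ne: "x \<noteq> t" "y \<noteq> t" "x \<noteq> s" "y \<noteq> s" using Ox assms disjoint by auto
  show "geodesic H [x, s, y, t]"
  proof (rule geodesic_if_length_ge)
    show "is_path H [x, s, y, t]" using E ne assms Ox verts by (simp add: is_path_simps)
    fix q assume "is_path H q" "hd q = hd [x, s, y, t]" "last q = last [x, s, y, t]"
    then show "length [x, s, y, t] \<le> length q"
      using length_ge_4_if_Ox_Si[of q] nonadj assms Ox by simp
  qed
  show "geodesic H [t, y, s, x]"
  proof (rule geodesic_if_length_ge)
    show "is_path H [t, y, s, x]" using E ne assms Ox verts by (simp add: is_path_simps)
    fix q assume "is_path H q" "hd q = hd [t, y, s, x]" "last q = last [t, y, s, x]"
    then show "length [t, y, s, x] \<le> length q"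
      using length_ge_4_if_Ox_Si[of q] nonadj assms Ox by simp
  qed
qed

lemma joined_if_Si_Ox_Si:
  assumes "is_path H p" "p = xs @ s # x # t # ys" "s \<in> Si"
  shows "joined s t"
proof -
  have "{s, x} \<in> edges H" "{x, t} \<in> edges H" "s \<noteq> t"
    using assms is_path_append_edge[of H "xs @ [s]" "x # t # ys"]
      is_path_append_edge[of H "xs @ [s, x]" "t # ys"] by (auto simp: is_path_def)
  moreover from this have "t \<in> Si" using edge_sides assms(3) disjoint by blast
  ultimately show ?thesis using assms(3)
    by (auto simp: joined_def nbrs_def insert_commute)
qed

text \<open>From four vertices on, one of the first two is silicon, and so is the vertex two places
  later. Paths of one or two vertices always extend, and an oxygen-silicon-oxygen path extends
  through any bridge at its ends.\<close>

lemma maximal_geodesic_cases: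
  assumes max: "maximal_geodesic H p"
  obtains s t where "joined s t" "s \<in> set p" "t \<in> set p"
  | s x y where "s \<in> Si" "p = [x, s, y]" "x \<noteq> y" "x \<in> pend s" "y \<in> pend s"
proof -
  have p: "is_path H p" using max by (simp add: maximal_geodesic_def geodesic_def)
  have extend: False if "geodesic H (x # p) \<or> geodesic H (p @ [x])" for x
    using that max not_maximal_geodesic_Cons[of H x p] not_maximal_geodesic_snoc[of H p x] by blast
  have two: "\<exists>y\<in>nbrs H s. y \<noteq> x" if "s \<in> Si" for s x
  proof (rule ccontr)
    assume "\<not> ?thesis"
    then have "nbrs H s \<subseteq> {x}" by blast
    then have "card (nbrs H s) \<le> 1" using card_mono[of "{x}"] by simp
    then show False using card_nbrs_Si[OF that] by simp
  qed
  have one: "nbrs H v \<noteq> {}" if "v \<in> verts H" for v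
    using that verts card_nbrs_Si[of v] card_nbrs_Ox[of v] by auto
  have no_two: False if "p = [s, x] \<or> p = [x, s]" "s \<in> Si" for s x
  proof -
    have x: "x \<in> nbrs H s" using that(1) p by (auto simp: is_path_simps nbrs_def insert_commute)
    obtain y where y: "y \<in> nbrs H s" "y \<noteq> x" using two[OF \<open>s \<in> Si\<close>] by blast
    show False
      using geodesic_Ox_Si_Ox[OF that(2) x y(1)] geodesic_Ox_Si_Ox[OF that(2) y(1) x] y(2)
        extend[of y] that(1) by auto
  qed
  consider "p = []" | u where "p = [u]" | u v where "p = [u, v]" | u v w where "p = [u, v, w]"
    | u v w x ys where "p = u # v # w # x # ys"
    by (metis list.exhaust)
  then show ?thesis
  proof cases
    case 1
    then show ?thesis using p by (simp add: is_path_def)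
  next
    case (2 u)
    then have "u \<in> verts H" using p by (simp add: is_path_simps)
    then obtain v where "{u, v} \<in> edges H" using one by (auto simp: nbrs_def)
    then have False using extend[of v] geodesic_two[of u v] 2 by simp
    then show ?thesis ..
  next
    case (3 u v)
    then have "{u, v} \<in> edges H" using p by (simp add: is_path_simps)
    then show ?thesis using no_two 3 edge_sides by blast
  next
    case (4 u v w)
    then have e: "{u, v} \<in> edges H" "{v, w} \<in> edges H" "u \<noteq> w" using p by (simp_all add: is_path_simps)
    show ?thesis
    proof (cases "u \<in> Si")
      case True
      then show ?thesis using joined_if_Si_Ox_Si[OF p, of "[]" u v w "[]"] 4 that(1) by simp
    next
      case False
      then have v: "v \<in> Si" using edge_sides e(1) by blast
      have uw: "u \<in> nbrs H v" "w \<in> nbrs H v" using e by (simp_all add: nbrs_def insert_commute)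
      have "u \<in> pend v"
        using v uw(1)
      proof (cases rule: nbrs_cases)
        \<comment> \<open>A bridge at the end leads on to a second silicon vertex \<open>t\<close>,
          against maximality.\<close>
        case (2 t)
        then have "geodesic H [t, u, v, w]"
          using geodesic_extend_bridge(2)[OF v uw(2,1)] e(3) by (simp add: joined_def)
        then show ?thesis using extend[of t] 4 by simp
      qed
      moreover have "w \<in> pend v"
        using v uw(2)
      proof (cases rule: nbrs_cases)
        case (2 t)
        then have "geodesic H [u, v, w, t]"
          using geodesic_extend_bridge(1)[OF v uw(1,2)] e(3) by (simp add: joined_def)
        then show ?thesis using extend[of t] 4 by simp
      qed
      ultimately show ?thesis using that(2)[OF v 4 e(3)] by simp
    qed
  next
    case (5 u v w x ys)
    then have "{u, v} \<in> edges H" using p by (simp add: is_path_simps)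
    then consider "u \<in> Si" | "v \<in> Si" using edge_sides by blast
    then show ?thesis
    proof cases
      case 1
      then show ?thesis using joined_if_Si_Ox_Si[OF p, of "[]" u v w "x # ys"] 5 that(1) by simp
    next
      case 2
      then show ?thesis using joined_if_Si_Ox_Si[OF p, of "[u]" v w x ys] 5 that(1) by simp
    qed
  qed
qed

section \<open>Disjoint maximal geodesics and the transversal number\<close>

lemma maximal_geodesic_pend_pend:
  assumes "s \<in> Si" "x \<in> pend s" "y \<in> pend s" "x \<noteq> y"
  shows "maximal_geodesic H [x, s, y]"
  using assms by (intro maximal_geodesic_if_ends_pendant geodesic_Ox_Si_Ox) (auto simp: pend_def)

text \<open>Every path from \<open>y\<close> to \<open>z\<close> has \<open>s\<close> right after
  \<open>y\<close> and \<open>t\<close> right before \<open>z\<close>. As \<open>s\<close> and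
  \<open>t\<close> are distinct and nonadjacent, a further vertex lies between them, so the path has
  at least five vertices.\<close>

lemma maximal_geodesic_pend_joined_pend:
  assumes "joined s t" "x \<in> nbrs H s" "x \<in> nbrs H t" "y \<in> pend s" "z \<in> pend t"
  shows "maximal_geodesic H [y, s, x, t, z]"
proof (rule maximal_geodesic_if_ends_pendant)
  have st: "s \<in> Si" "t \<in> Si" "s \<noteq> t" using assms(1) by (auto simp: joined_def)
  have yz: "nbrs H y = {s}" "nbrs H z = {t}" "y \<in> nbrs H s" "z \<in> nbrs H t"
    using assms by (auto simp: pend_def)
  have Ox: "x \<in> Ox" "y \<in> Ox" "z \<in> Ox" using assms(2) yz st nbrs_Si by auto
  have "{s, t} \<subseteq> nbrs H x" using assms by (simp add: nbrs_sym)
  then have ne: "x \<noteq> y" "x \<noteq> z" "y \<noteq> z" using yz st by auto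
  show "geodesic H [y, s, x, t, z]"
  proof (rule geodesic_if_length_ge)
    show "is_path H [y, s, x, t, z]"
      using ne st Ox disjoint verts yz assms by (auto simp: is_path_simps edge_iff_nbrs nbrs_sym)
    fix q assume q: "is_path H q" "hd q = hd [y, s, x, t, z]" "last q = last [y, s, x, t, z]"
    show "length [y, s, x, t, z] \<le> length q"
    proof (rule ccontr)
      assume "\<not> ?thesis"
      then have "length q \<le> 4" by simp
      then consider "q = []" | u where "q = [u]" | u v where "q = [u, v]"
        | u v w where "q = [u, v, w]" | u v w w' where "q = [u, v, w, w']"
        by (auto simp: le_Suc_eq eval_nat_numeral length_Suc_conv)
      then show False
      proof cases
        case 3
        then show False using q Ox Ox_nonadjacent by (auto simp: is_path_simps)
      next
        case 4
        then have "v \<in> nbrs H y" "v \<in> nbrs H z"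
          using q by (auto simp: is_path_simps edge_iff_nbrs nbrs_sym)
        then show False using yz st by auto
      next
        case 5
        then have "v \<in> nbrs H y" "w \<in> nbrs H z" "{v, w} \<in> edges H"
          using q by (auto simp: is_path_simps edge_iff_nbrs nbrs_sym)
        then show False using yz st Si_nonadjacent by auto
      qed (use q ne in \<open>auto simp: is_path_def\<close>)
    qed
  qed
  show "nbrs H (hd [y, s, x, t, z]) = {s}" "nbrs H (last [y, s, x, t, z]) = {t}"
    using yz by simp_all
qed simp

text \<open>\<open>C\<close> serves for both bounds: it is the transversal, and each of its vertices
  carries one of the disjoint maximal geodesics. A vertex with a single pendant neighbour borrows a
  pendant neighbour of its partner \<open>m s\<close> outside \<open>C\<close>, and injectivity of
  \<open>m\<close> keeps these geodesics disjoint.\<close>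

theorem gt_eq_card:
  assumes C: "C \<subseteq> Si" "\<And>s. s \<in> Si \<Longrightarrow> card (pend s) \<ge> 2 \<Longrightarrow> s \<in> C"
    and cover: "\<And>s t. joined s t \<Longrightarrow> s \<in> C \<or> t \<in> C"
    and pend: "\<And>s. s \<in> Si \<Longrightarrow> pend s \<noteq> {}"
    and m: "\<And>s. s \<in> C \<Longrightarrow> card (pend s) < 2 \<Longrightarrow> joined s (m s) \<and> m s \<notin> C"
    and inj: "inj_on m {s \<in> C. card (pend s) < 2}"
  shows "gt H = card C"
  unfolding gt_def
proof (rule Least_equality)
  show "\<exists>S. geodesic_transversal H S \<and> finite S \<and> card S = card C"
  proof (intro exI[of _ C] conjI refl)
    show "finite C" using C(1) finite_verts finite_subset by blast
    show "geodesic_transversal H C"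
      unfolding geodesic_transversal_def
    proof (intro conjI allI impI)
      show "C \<subseteq> verts H" using C(1) verts by blast
      fix p assume "maximal_geodesic H p"
      then show "set p \<inter> C \<noteq> {}"
      proof (cases rule: maximal_geodesic_cases)
        case (1 s t)
        then show ?thesis using cover by blast
      next
        case (2 s x y)
        then have "card {x, y} \<le> card (pend s)" using finite_pend by (intro card_mono) auto
        then show ?thesis using C(2)[of s] 2 by auto
      qed
    qed
  qed
next
  fix k assume "\<exists>S. geodesic_transversal H S \<and> finite S \<and> card S = k"
  then obtain S where S: "geodesic_transversal H S" "finite S" "card S = k" by blast
  \<comment> \<open>\<open>T s\<close> holds the silicon vertices of the geodesic chosen at
    \<open>s\<close>. The oxygen vertices of this geodesic have all their neighbours in
    \<open>T s\<close>, so disjointness of the sets \<open>T s\<close> makes the geodesics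
    disjoint.\<close>
  define T where "T s = (if card (pend s) < 2 then {s, m s} else {s})" for s
  have T_disjoint: "T s \<inter> T t = {}" if "s \<in> C" "t \<in> C" "s \<noteq> t" for s t
    using that m[of s] m[of t] inj_onD[OF inj, of s t] by (auto simp: T_def)
  have "\<exists>x. x \<in> S \<and> (x \<in> T s \<or> x \<in> Ox \<and> nbrs H x \<subseteq> T s)" if s: "s \<in> C" for s
  proof (cases "card (pend s) < 2")
    case True
    then have st: "joined s (m s)" "T s = {s, m s}" using m s by (auto simp: T_def)
    then obtain x y z where x: "x \<in> nbrs H s" "x \<in> nbrs H (m s)" and y: "y \<in> pend s" and z: "z \<in> pend (m s)"
      using pend[of s] pend[of "m s"] unfolding joined_def by blast
    have "nbrs H x = {s, m s}" using nbrs_common st(1) x by blast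
    moreover have "{x, y, z} \<subseteq> Ox" using x y z st nbrs_Si by (auto simp: pend_def joined_def)
    moreover have "set [y, s, x, m s, z] \<inter> S \<noteq> {}"
      using maximal_geodesic_pend_joined_pend[OF st(1) x y z] S(1)
      unfolding geodesic_transversal_def by blast
    ultimately show ?thesis using y z st by (auto simp: pend_def)
  next
    case False
    then have "1 < card (pend s)" by simp
    then obtain x y where xy: "x \<in> pend s" "y \<in> pend s" "x \<noteq> y"
      using card_le_Suc0_iff_eq[OF finite_pend, of s] s C(1) by fastforce
    then have "set [x, s, y] \<inter> S \<noteq> {}"
      using maximal_geodesic_pend_pend[of s x y] S(1) s C(1) unfolding geodesic_transversal_def by blast
    moreover have "{x, y} \<subseteq> Ox" using xy s C(1) nbrs_Si by (auto simp: pend_def)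
    ultimately show ?thesis using xy False by (auto simp: pend_def T_def)
  qed
  then obtain h where h: "h s \<in> S" "h s \<in> T s \<or> h s \<in> Ox \<and> nbrs H (h s) \<subseteq> T s" if "s \<in> C" for s
    by metis
  have "inj_on h C"
  \<comment> \<open>Only an oxygen vertex could be shared, and all its neighbours would lie in two
    disjoint sets at once, although it has at least one.\<close>
  proof (rule inj_onI, rule ccontr)
    fix s t assume st: "s \<in> C" "t \<in> C" "h s = h t" "s \<noteq> t"
    have "T s \<subseteq> Si" "T t \<subseteq> Si" using C(1) m st(1,2) by (auto simp: T_def joined_def)
    then have Ox: "h s \<in> Ox" "nbrs H (h s) \<subseteq> T s \<inter> T t"
      using h(2)[OF st(1)] h(2)[OF st(2)] T_disjoint[OF st(1,2,4)] st(3) disjoint by auto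
    then show False
      using T_disjoint[OF st(1,2,4)] card_nbrs_Ox[OF Ox(1)] by simp
  qed
  then have "card C \<le> card S" using h(1) S(2) by (intro card_inj_on_le) auto
  then show "card C \<le> k" using S(3) by simp
qed

end

lemma silicate_sheetE:
  assumes "silicate_sheet H"
  obtains Si Ox where "silicate H Si Ox"
proof -
  have "\<exists>Si Ox. silicate H Si Ox"
    using assms unfolding silicate_sheet_def
    by (elim conjE ex_forward) (simp add: silicate_def)
  then show thesis using that by blast
qed

section \<open>Hexagonal silicate sheets\<close>

theorem mainTheorem6:
  fixes r :: nat and H :: "'a ugraph"
  assumes "r \<ge> 1"
    and "hexagonal_silicate_sheet r H"
  shows "gt H = 3 * (r\<^sup>2 + r)"
proof -
  let ?G = "nanosheet r"
  from assms(2) obtain M where "silicate_sheet H" and M: "is_SM H M"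
    "isomorphic (delete_pendant M) ?G"
    unfolding hexagonal_silicate_sheet_def by blast
  then obtain Si Ox where "silicate H Si Ox" using silicate_sheetE by blast
  then interpret silicate H Si Ox .
  have "isomorphic \<lparr> verts = Si, edges = {{s, t} | s t. joined s t} \<rparr> ?G"
    using M delete_pendant_SM by simp
  then obtain f where bij: "bij_betw f Si (verts ?G)"
    and f: "\<And>s t. s \<in> Si \<Longrightarrow> t \<in> Si \<Longrightarrow>
      {s, t} \<in> {{s, t} | s t. joined s t} \<longleftrightarrow> {f s, f t} \<in> edges ?G"
    unfolding isomorphic_def by auto
  have joined_sym: "joined s t \<longleftrightarrow> joined t s" for s t
    by (auto simp: joined_def)
  have joined_iff: "joined s t \<longleftrightarrow> {f s, f t} \<in> edges ?G" if "s \<in> Si" "t \<in> Si" for s t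
    using f[OF that] joined_sym by (auto simp: doubleton_eq_iff)
  have f_verts: "f s \<in> verts ?G" if "s \<in> Si" for s
    using that bij bij_betwE by blast
  \<comment> \<open>Thus vertices of degree 2 and 3 in the sheet have two and one pendant
    neighbours, which translates the hypotheses of \<open>gt_eq_card\<close> into degrees.\<close>
  have pend_degree: "card (pend s) + degree ?G (f s) = 4" if s: "s \<in> Si" for s
  proof -
    have "f ` {t. joined s t} = nbrs ?G (f s)"
    proof (intro equalityI subsetI)
      fix v assume "v \<in> f ` {t. joined s t}"
      then obtain t where "v = f t" "joined s t" by blast
      moreover from this have "t \<in> Si" by (simp add: joined_def)
      ultimately show "v \<in> nbrs ?G (f s)" using joined_iff[OF s] by (simp add: nbrs_def)
    next
      fix v assume v: "v \<in> nbrs ?G (f s)"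
      then have "v \<in> f ` Si"
        using nbrs_nanosheet_subset[of r "f s"] bij bij_betw_imp_surj_on by blast
      then obtain t where "t \<in> Si" "v = f t" by blast
      then show "v \<in> f ` {t. joined s t}" using v joined_iff[OF s] by (auto simp: nbrs_def)
    qed
    moreover have "inj_on f {t. joined s t}"
      using bij by (auto simp: bij_betw_def joined_def intro: inj_on_subset)
    ultimately have "degree ?G (f s) = card {t. joined s t}"
      unfolding degree_def using card_image by metis
    then show ?thesis using card_pend_joined[OF s] by simp
  qed
  have degree_cases: "degree ?G (f s) = 2 \<or> degree ?G (f s) = 3" if "s \<in> Si" for s
    using degree_nanosheet[OF assms(1) f_verts[OF that]] by blast
  \<comment> \<open>The class \<open>False\<close> meets every edge of the sheet, as
    \<open>cover\<close> demands. The class \<open>True\<close> contributes only its vertices with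
    two pendant neighbours.\<close>
  define C where "C = {s \<in> Si. snd (snd (f s)) \<longrightarrow> degree ?G (f s) = 2}"
  \<comment> \<open>These are the spokes pulled back along \<open>f\<close>. \<open>inv_into\<close>
    is meaningful only where the spoke stays in the sheet, which is guaranteed at
    \<open>False\<close> vertices of degree 3, the only ones in \<open>C\<close> with fewer than two
    pendant neighbours.\<close>
  define m where "m s = inv_into Si f (spoke (f s))" for s
  have m: "m s \<in> Si" "f (m s) = spoke (f s)" "\<not> snd (snd (f s))" "f s \<in> verts ?G" "degree ?G (f s) = 3"
    if "s \<in> C" "card (pend s) < 2" for s
  proof -
    have s: "s \<in> Si" using that(1) by (simp add: C_def)
    show d: "degree ?G (f s) = 3" using degree_cases[OF s] pend_degree[OF s] that(2) by auto
    then show F: "\<not> snd (snd (f s))" using that(1) by (simp add: C_def)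
    show v: "f s \<in> verts ?G" using f_verts s .
    have "spoke (f s) \<in> f ` Si" using spoke(3)[OF assms(1) v F d] bij by (simp add: bij_betw_def)
    then show "m s \<in> Si" "f (m s) = spoke (f s)"
      unfolding m_def by (rule inv_into_into, rule f_inv_into_f)
  qed
  have "gt H = card C"
  proof (rule gt_eq_card[where m = m])
    show "C \<subseteq> Si" by (auto simp: C_def)
    show "s \<in> C" if "s \<in> Si" "2 \<le> card (pend s)" for s
      using degree_cases[OF that(1)] pend_degree[OF that(1)] that by (auto simp: C_def)
    show "s \<in> C \<or> t \<in> C" if "joined s t" for s t
    proof -
      have "s \<in> Si" "t \<in> Si" using that by (simp_all add: joined_def)
      then show ?thesis
        using that joined_iff nanosheet_edge_bipartite[of "f s" "f t"] by (auto simp: C_def)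
    qed
    show "pend s \<noteq> {}" if "s \<in> Si" for s
      using degree_cases[OF that] pend_degree[OF that] by auto
    show "joined s (m s) \<and> m s \<notin> C" if "s \<in> C" "card (pend s) < 2" for s
    proof
      note sp = spoke[OF assms(1) m(4)[OF that] m(3)[OF that] m(5)[OF that]]
      have "s \<in> Si" using that by (simp add: C_def)
      then show "joined s (m s)" using joined_iff m(1,2)[OF that] sp(1) by simp
      \<comment> \<open>The spoke ends at a \<open>True\<close> vertex of degree 3, and no such
        vertex is in the image of \<open>C\<close>.\<close>
      show "m s \<notin> C" using m(2)[OF that] sp(2,4) by (simp add: C_def)
    qed
    show "inj_on m {s \<in> C. card (pend s) < 2}"
    proof (rule inj_onI)
      fix s t assume s: "s \<in> {s \<in> C. card (pend s) < 2}" and t: "t \<in> {s \<in> C. card (pend s) < 2}"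
        and eq: "m s = m t"
      then have "spoke (f s) = spoke (f t)" using m(2)[of s] m(2)[of t] by simp
      then have "f s = f t" using inj_onD[OF inj_on_spoke] m(3)[of s] m(3)[of t] s t by simp
      then show "s = t" using s t bij by (auto simp: C_def bij_betw_def dest: inj_onD)
    qed
  qed
  also have "\<dots> = card (f ` C)"
    using bij by (intro card_image[symmetric]) (auto simp: bij_betw_def C_def intro: inj_on_subset)
  also have "f ` C = {v \<in> verts ?G. \<not> snd (snd v)} \<union>
      {v \<in> verts ?G. snd (snd v) \<and> degree ?G v = 2}"
  proof -
    have "f ` C = {v \<in> f ` Si. snd (snd v) \<longrightarrow> degree ?G v = 2}" by (auto simp: C_def)
    then show ?thesis using bij by (auto simp: bij_betw_def)
  qed
  also have "card \<dots> = 3 * r\<^sup>2 + 3 * r"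
  proof -
    have "finite (verts ?G)" using bij finite_verts(1) bij_betw_finite by blast
    then show ?thesis
      by (subst card_Un_disjoint)
        (auto simp: card_nanosheet_False[OF assms(1)] card_nanosheet_True_degree_2[OF assms(1)])
  qed
  finally show ?thesis by simp
qed

end
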